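(* Let $X$ be a real or complex Banach space with dual space $X^*$, let $A:\mathbb{N}\to\mathcal{B}(X)$ be a sequence, and consider the linear discrete-time system $x_{n+1}=A(n)x_n$ with associated operators $A_m^n$, $(m,n)\in\Delta$. If there exist a constant $b>0$ and a nondecreasing function $N:\mathbb{R}_+\to[1,\infty)$ such that $$\sum_{k=n}^{m}e^{b(m-k)}\|(A_m^k)^*x^*\|\le N(n)\|x^*\|\quad\text{for all }(m,n)\in\Delta\text{ and }x^*\in X^*,$$ then the system is nonuniformly exponentially stable.
   Context: $\mathbb{N}=\{0,1,2,\dots\}$ and $\mathbb{R}_+=[0,\infty)$. $\mathcal{B}(X)$ is the Banach algebra of bounded linear operators on $X$, and $I$ is the identity operator. $\Delta$ is the set of pairs $(m,n)$ of nonnegative integers with $m\ge n$. $T$ is the set of triples $(m,n,p)$ of nonnegative integers with $(m,n)\in\Delta$ and $(n,p)\in\Delta$. For $(m,n)\in\Delta$, $A_m^n=A(m)A(m-1)\cdots A(n+1)$ if $m\ge n+1$, and $A_m^n=I$ if $m=n$. $X^*$ is the Banach space of continuous linear functionals on $X$, and $(A_m^k)^*:X^*\to X^*$ is the adjoint (dual) operator of $A_m^k$. The system is nonuniformly exponentially stable if there exist a constant $\alpha>0$ and a nondecreasing function $N:\mathbb{R}_+\to[1,\infty)$ such that $\|A_m^p x\|\le N(n)e^{-\alpha(m-n)}\|A_n^p x\|$ for all $(m,n,p)\in T$ and $x\in X$. *)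

theory Defs
  imports "HOL-Analysis.Analysis"
begin

text \<open>
  The library class of Banach spaces only provides real scalars.  To treat real and complex
  scalars at once, the scalar field is a type of the class below: its axiom says that the type
  is a copy of \<open>\<real>\<close> or of \<open>\<complex>\<close>, as a normed real algebra.
\<close>

class real_or_complex = real_normed_field +
  assumes ex_iso_real_or_complex:
    "\<exists>h :: 'a \<Rightarrow> complex.
       (\<forall>x y. h (x + y) = h x + h y) \<and>
       (\<forall>x y. h (x * y) = h x * h y) \<and>
       (\<forall>r x. h (r *\<^sub>R x) = r *\<^sub>R h x) \<and>
       (\<forall>x. norm (h x) = norm x) \<and>
       (range h = \<real> \<or> range h = UNIV)"

instance real :: real_or_complex
proof
  show "\<exists>h :: real \<Rightarrow> complex.
       (\<forall>x y. h (x + y) = h x + h y) \<and>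
       (\<forall>x y. h (x * y) = h x * h y) \<and>
       (\<forall>r x. h (r *\<^sub>R x) = r *\<^sub>R h x) \<and>
       (\<forall>x. norm (h x) = norm x) \<and>
       (range h = \<real> \<or> range h = UNIV)"
    by (rule exI[of _ complex_of_real]) (simp add: Reals_def scaleR_conv_of_real)
qed

instance complex :: real_or_complex
proof
  show "\<exists>h :: complex \<Rightarrow> complex.
       (\<forall>x y. h (x + y) = h x + h y) \<and>
       (\<forall>x y. h (x * y) = h x * h y) \<and>
       (\<forall>r x. h (r *\<^sub>R x) = r *\<^sub>R h x) \<and>
       (\<forall>x. norm (h x) = norm x) \<and>
       (range h = \<real> \<or> range h = UNIV)"
    by (rule exI[of _ "\<lambda>x. x"]) simp
qed

text \<open>
  A Banach space over \<open>'k\<close> is a real Banach space (which supplies addition, norm and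
  completeness) with a compatible scalar multiplication by \<open>'k\<close>.
\<close>

locale banach_space_over = vector_space scl
  for scl :: "'k::real_or_complex \<Rightarrow> 'x::banach \<Rightarrow> 'x" +
  assumes scl_of_real: "scl (of_real r) x = r *\<^sub>R x"
    and norm_scl: "norm (scl c x) = norm c * norm x"

text \<open>
  The type of bounded linear functions refers to real-linearity, so linearity over \<open>'k\<close>
  is imposed separately.  The operator norm does not depend on the scalar field.
\<close>

definition bounded_operators :: "('k::real_or_complex \<Rightarrow> 'x::banach \<Rightarrow> 'x) \<Rightarrow> ('x \<Rightarrow>\<^sub>L 'x) set" where
  "bounded_operators scl = {S. \<forall>c x. blinfun_apply S (scl c x) = scl c (blinfun_apply S x)}"

definition dual_space :: "('k::real_or_complex \<Rightarrow> 'x::banach \<Rightarrow> 'x) \<Rightarrow> ('x \<Rightarrow>\<^sub>L 'k) set" where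
  "dual_space scl = {\<phi>. \<forall>c x. blinfun_apply \<phi> (scl c x) = c * blinfun_apply \<phi> x}"

text \<open>The Banach space adjoint; the library constant \<open>adjoint\<close> is the one for inner product spaces.\<close>

definition dual_operator ::
    "('x::real_normed_vector \<Rightarrow>\<^sub>L 'x) \<Rightarrow> ('x \<Rightarrow>\<^sub>L 'k::real_normed_vector) \<Rightarrow> ('x \<Rightarrow>\<^sub>L 'k)" where
  "dual_operator S \<phi> = \<phi> o\<^sub>L S"

lemma dual_operator_in_dual_space:
  "S \<in> bounded_operators scl \<Longrightarrow> \<phi> \<in> dual_space scl \<Longrightarrow> dual_operator S \<phi> \<in> dual_space scl"
  by (simp add: bounded_operators_def dual_space_def dual_operator_def)

text \<open>
  \<open>evolution A m n\<close> is \<open>A m o\<^sub>L \<dots> o\<^sub>L A (n + 1)\<close> for \<open>n \<le> m\<close>; it is only used for such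
  pairs (the value for \<open>m < n\<close> is a dummy).
\<close>

primrec evolution :: "(nat \<Rightarrow> 'x::real_normed_vector \<Rightarrow>\<^sub>L 'x) \<Rightarrow> nat \<Rightarrow> nat \<Rightarrow> 'x \<Rightarrow>\<^sub>L 'x" where
  "evolution A 0 n = id_blinfun"
| "evolution A (Suc m) n = (if n \<le> m then A (Suc m) o\<^sub>L evolution A m n else id_blinfun)"

lemma evolution_refl: "evolution A n n = id_blinfun"
  by (cases n) auto

text \<open>Nondecreasing functions from \<open>[0, \<infinity>)\<close> to \<open>[1, \<infinity>)\<close>; values at negative arguments are irrelevant.\<close>

definition nondecreasing_bound :: "(real \<Rightarrow> real) \<Rightarrow> bool" where
  "nondecreasing_bound N \<longleftrightarrow> N \<in> {0..} \<rightarrow> {1..} \<and> mono_on {0..} N"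

definition nonuniformly_exponentially_stable ::
    "(nat \<Rightarrow> 'x::real_normed_vector \<Rightarrow>\<^sub>L 'x) \<Rightarrow> bool" where
  "nonuniformly_exponentially_stable A \<longleftrightarrow>
     (\<exists>\<alpha> N. \<alpha> > 0 \<and> nondecreasing_bound N \<and>
       (\<forall>m n p x. n \<le> m \<and> p \<le> n \<longrightarrow>
          norm (blinfun_apply (evolution A m p) x)
            \<le> N (real n) * exp (- \<alpha> * (real m - real n)) * norm (blinfun_apply (evolution A n p) x)))"

end

theory Submission
  imports Defs
begin

text \<open>
  The term \<open>k = n\<close> of the sum alone bounds \<open>\<bar>\<phi> (A\<^sub>m\<^sup>n y)\<bar>\<close> by
  \<open>N(n) exp (- b (m - n)) \<parallel>\<phi>\<parallel> \<parallel>y\<parallel>\<close>.  Taking for \<open>\<phi>\<close> a functional that norms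
  \<open>A\<^sub>m\<^sup>n y\<close>, which exists by the Hahn--Banach theorem, and \<open>y = A\<^sub>n\<^sup>p x\<close> gives stability
  with the same \<open>N\<close> and \<open>\<alpha> = b\<close>.  For the Hahn--Banach theorem: a minimal sublinear
  functional is linear.
\<close>

section \<open>Sublinear functionals and their infima\<close>

definition sublinear :: "('a::real_vector \<Rightarrow> real) \<Rightarrow> bool" where
  "sublinear q \<longleftrightarrow>
     (\<forall>x y. q (x + y) \<le> q x + q y) \<and> (\<forall>c>0. \<forall>x. q (c *\<^sub>R x) \<le> c * q x)"

lemma sublinear_add: "sublinear q \<Longrightarrow> q (x + y) \<le> q x + q y"
  by (simp add: sublinear_def)

lemma sublinear_scale_le: "sublinear q \<Longrightarrow> c > 0 \<Longrightarrow> q (c *\<^sub>R x) \<le> c * q x"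
  by (simp add: sublinear_def)

text \<open>Subadditivity at \<open>0\<close> gives \<open>0 \<le> q 0\<close>, and the factor
  \<open>1/2\<close> gives \<open>q 0 \<le> 0\<close>.\<close>

lemma sublinear_zero:
  assumes "sublinear q"
  shows "q 0 = 0"
  using sublinear_add[OF assms, of 0 0] sublinear_scale_le[OF assms, of "1/2" 0] by simp

text \<open>The definition asks only for an inequality, which is easy to check for infima; the same
  inequality for \<open>inverse c\<close> at \<open>c *\<^sub>R x\<close> reverses it.\<close>

lemma sublinear_scale:
  assumes "sublinear q" "c \<ge> 0"
  shows "q (c *\<^sub>R x) = c * q x"
proof (cases "c = 0")
  case True
  then show ?thesis by (simp add: sublinear_zero[OF assms(1)])
next
  case False
  then have c: "c > 0" using assms(2) by simp
  have "q x \<le> inverse c * q (c *\<^sub>R x)"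
    using sublinear_scale_le[OF assms(1), of "inverse c" "c *\<^sub>R x"] c by simp
  then have "c * q x \<le> q (c *\<^sub>R x)"
    using c by (simp add: field_simps)
  then show ?thesis using sublinear_scale_le[OF assms(1) c, of x] by simp
qed

lemma sublinear_ge_minus:
  assumes "sublinear q"
  shows "- q (- x) \<le> q x"
  using sublinear_add[OF assms, of x "- x"] sublinear_zero[OF assms] by simp

text \<open>A common criterion for two infima: the perturbation, over \<open>t \<ge> 0\<close>, and
  the lower bound of a chain in Zorn's lemma.\<close>

lemma sublinear_INF:
  fixes g :: "'i \<Rightarrow> 'a::real_vector \<Rightarrow> real"
  assumes "I \<noteq> {}"
    and bdd: "\<And>x. bdd_below ((\<lambda>i. g i x) ` I)"
    and add: "\<And>i j x y. i \<in> I \<Longrightarrow> j \<in> I \<Longrightarrow> \<exists>k\<in>I. g k (x + y) \<le> g i x + g j y"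
    and scale: "\<And>i c x. i \<in> I \<Longrightarrow> c > 0 \<Longrightarrow> \<exists>k\<in>I. g k (c *\<^sub>R x) \<le> c * g i x"
  shows "sublinear (\<lambda>x. INF i\<in>I. g i x)"
  unfolding sublinear_def
proof (intro conjI allI impI)
  fix x y
  have *: "(INF k\<in>I. g k (x + y)) \<le> g i x + g j y" if "i \<in> I" "j \<in> I" for i j
    using add[OF that, of x y] cINF_lower2[OF bdd] by blast
  have "(INF k\<in>I. g k (x + y)) - g j y \<le> (INF i\<in>I. g i x)" if "j \<in> I" for j
    using *[OF _ that] by (intro cINF_greatest[OF assms(1)]) (simp add: diff_le_eq)
  then have "(INF k\<in>I. g k (x + y)) - (INF i\<in>I. g i x) \<le> (INF j\<in>I. g j y)"
    by (intro cINF_greatest[OF assms(1)]) (simp add: algebra_simps)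
  then show "(INF k\<in>I. g k (x + y)) \<le> (INF i\<in>I. g i x) + (INF j\<in>I. g j y)"
    by simp
next
  fix c :: real and x
  assume c: "c > 0"
  have "(INF k\<in>I. g k (c *\<^sub>R x)) \<le> c * g i x" if "i \<in> I" for i
    using scale[OF that c, of x] cINF_lower2[OF bdd] by blast
  then have "(INF k\<in>I. g k (c *\<^sub>R x)) / c \<le> (INF i\<in>I. g i x)"
    using c by (intro cINF_greatest[OF assms(1)]) (simp add: field_simps)
  then show "(INF k\<in>I. g k (c *\<^sub>R x)) \<le> c * (INF i\<in>I. g i x)"
    using c by (simp add: field_simps)
qed

text \<open>
  The perturbation is sublinear and at most \<open>q\<close>, and it is at most \<open>- q y\<close> at \<open>- y\<close>.  It thus
  serves both to show that minimal sublinear functionals are additive and to prescribe the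
  value at one vector.
\<close>

definition sublinear_perturb :: "('a::real_vector \<Rightarrow> real) \<Rightarrow> 'a \<Rightarrow> 'a \<Rightarrow> real" where
  "sublinear_perturb q y x = (INF t\<in>{0..}. q (x + t *\<^sub>R y) - t * q y)"

text \<open>Ensures that the real \<open>INF\<close> is a genuine infimum: \<open>- q (- x)\<close>
  is a lower bound independent of \<open>t\<close>, by subadditivity applied to
  \<open>t *\<^sub>R y = (x + t *\<^sub>R y) + (- x)\<close>.\<close>

lemma sublinear_perturb_bdd:
  assumes "sublinear q"
  shows "bdd_below ((\<lambda>t. q (x + t *\<^sub>R y) - t * q y) ` {0..})"
proof (rule bdd_belowI2)
  fix t :: real
  assume "t \<in> {0..}"
  then have "t * q y = q ((x + t *\<^sub>R y) + (- x))"
    by (simp add: sublinear_scale[OF assms])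
  then show "- q (- x) \<le> q (x + t *\<^sub>R y) - t * q y"
    using sublinear_add[OF assms, of "x + t *\<^sub>R y" "- x"] by linarith
qed

lemma sublinear_perturb_le:
  assumes "sublinear q" "t \<ge> 0"
  shows "sublinear_perturb q y x \<le> q (x + t *\<^sub>R y) - t * q y"
  unfolding sublinear_perturb_def
  by (rule cINF_lower[OF sublinear_perturb_bdd[OF assms(1)]]) (use assms(2) in simp)

text \<open>The parameters combine like the vectors: \<open>s + t\<close> serves for a sum and
  \<open>c * t\<close> for a multiple.\<close>

lemma sublinear_sublinear_perturb:
  assumes "sublinear q"
  shows "sublinear (sublinear_perturb q y)"
proof -
  have "sublinear (\<lambda>x. INF t\<in>{0..}. q (x + t *\<^sub>R y) - t * q y)"
  proof (rule sublinear_INF)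
    fix s t :: real and u v
    assume "s \<in> {0..}" "t \<in> {0..}"
    moreover have "q (u + v + (s + t) *\<^sub>R y) \<le> q (u + s *\<^sub>R y) + q (v + t *\<^sub>R y)"
      using sublinear_add[OF assms, of "u + s *\<^sub>R y" "v + t *\<^sub>R y"]
      by (simp add: algebra_simps)
    ultimately show "\<exists>k\<in>{0..}. q (u + v + k *\<^sub>R y) - k * q y
        \<le> (q (u + s *\<^sub>R y) - s * q y) + (q (v + t *\<^sub>R y) - t * q y)"
      by (intro bexI[of _ "s + t"]) (auto simp: algebra_simps)
  next
    fix t c :: real and x
    assume "t \<in> {0..}" "c > 0"
    moreover have "q (c *\<^sub>R x + (c * t) *\<^sub>R y) \<le> c * q (x + t *\<^sub>R y)"
      using sublinear_scale_le[OF assms \<open>c > 0\<close>, of "x + t *\<^sub>R y"]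
      by (simp add: algebra_simps)
    ultimately show "\<exists>k\<in>{0..}. q (c *\<^sub>R x + k *\<^sub>R y) - k * q y
        \<le> c * (q (x + t *\<^sub>R y) - t * q y)"
      by (intro bexI[of _ "c * t"]) (auto simp: algebra_simps)
  qed (use sublinear_perturb_bdd[OF assms] in auto)
  then show ?thesis unfolding sublinear_perturb_def .
qed

section \<open>Minimal sublinear functionals and the Hahn-Banach theorem\<close>

lemma minimal_sublinear_linear:
  assumes q: "sublinear q"
    and min: "\<And>r. sublinear r \<Longrightarrow> (\<And>x. r x \<le> q x) \<Longrightarrow> r = q"
  shows "linear q"
proof -
  have add: "q (x + y) = q x + q y" for x y
  proof -
    \<comment> \<open>The parameter \<open>t = 0\<close> puts the perturbation below
      \<open>q\<close>, so minimality forces equality; \<open>t = 1\<close> then yields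
      superadditivity.\<close>
    have "sublinear_perturb q y = q"
    proof (rule min[OF sublinear_sublinear_perturb[OF q]])
      show "sublinear_perturb q y x \<le> q x" for x
        using sublinear_perturb_le[OF q, of 0 y x] by simp
    qed
    then have "q x \<le> q (x + y) - q y"
      using sublinear_perturb_le[OF q, of 1 y x] by simp
    then show ?thesis using sublinear_add[OF q, of x y] by simp
  qed
  have minus: "q (- x) = - q x" for x
    using add[of x "- x"] sublinear_zero[OF q] by simp
  have "q (c *\<^sub>R x) = c * q x" for c x
  proof (cases "c \<ge> 0")
    case True
    then show ?thesis by (rule sublinear_scale[OF q])
  next
    case False
    then show ?thesis
      using sublinear_scale[OF q, of "- c" x] minus[of "c *\<^sub>R x"] by simp
  qed
  with add show ?thesis by (intro linearI) auto
qed

lemma linear_le_sublinear: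
  fixes p :: "'a::real_vector \<Rightarrow> real"
  assumes p: "sublinear p"
  obtains f where "linear f" "\<And>x. f x \<le> p x"
proof -
  define S where "S = {q. sublinear q \<and> q \<le> p}"
  \<comment> \<open>Zorn's lemma for the reversed order, so that a maximal element is a minimal
    functional.\<close>
  have "\<exists>m\<in>S. \<forall>a\<in>S. m \<ge> a \<longrightarrow> a = m"
  proof (rule predicate_Zorn)
    show "partial_order_on S (relation_of (\<ge>) S)"
      by (rule partial_order_on_relation_ofI) auto
    fix C
    assume C: "C \<in> Chains (relation_of (\<ge>) S)"
    then have CS: "C \<subseteq> S" and tot: "\<And>q r. q \<in> C \<Longrightarrow> r \<in> C \<Longrightarrow> q \<le> r \<or> r \<le> q"
      by (auto simp: Chains_def relation_of_def)
    show "\<exists>u\<in>S. \<forall>a\<in>C. a \<ge> u"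
    \<comment> \<open>The infimum over an empty chain carries no information; there \<open>p\<close>
      itself is the bound.\<close>
    proof (cases "C = {}")
      case True
      then show ?thesis using p by (auto simp: S_def)
    next
      case False
      define u where "u = (\<lambda>x. INF q\<in>C. q x)"
      have bdd: "bdd_below ((\<lambda>q. q x) ` C)" for x
      proof (rule bdd_belowI2)
        fix q
        assume "q \<in> C"
        then have "sublinear q" "q (- x) \<le> p (- x)"
          using CS by (auto simp: S_def le_fun_def)
        then show "- p (- x) \<le> q x"
          using sublinear_ge_minus[of q x] by linarith
      qed
      have lower: "u \<le> q" if "q \<in> C" for q
        unfolding u_def le_fun_def using cINF_lower[OF bdd that] by blast
      have "sublinear u"
        unfolding u_def
      proof (rule sublinear_INF[OF False bdd])
        fix q r x y
        assume qr: "q \<in> C" "r \<in> C"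
        \<comment> \<open>In a chain the smaller of \<open>q\<close> and \<open>r\<close> works for
          both.\<close>
        obtain s where s: "s \<in> C" "s \<le> q" "s \<le> r"
          using tot[OF qr] qr by blast
        have "s (x + y) \<le> s x + s y"
          using s(1) CS by (auto simp: S_def intro: sublinear_add)
        also have "\<dots> \<le> q x + r y"
          using s(2,3) by (simp add: le_fun_def add_mono)
        finally show "\<exists>s\<in>C. s (x + y) \<le> q x + r y"
          using s(1) by blast
      next
        fix q c x
        assume "q \<in> C" "(c::real) > 0"
        then show "\<exists>s\<in>C. s (c *\<^sub>R x) \<le> c * q x"
          using CS by (intro bexI[of _ q] sublinear_scale_le) (auto simp: S_def)
      qed
      moreover have "u \<le> p"
      proof -
        obtain q where "q \<in> C" using False by blast
        then show ?thesis using lower[of q] CS order_trans[of u q p] by (auto simp: S_def)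
      qed
      ultimately show ?thesis
        using lower by (auto simp: S_def)
    qed
  qed
  then obtain m where m: "m \<in> S" and min: "\<And>a. a \<in> S \<Longrightarrow> a \<le> m \<Longrightarrow> a = m"
    by blast
  have "linear m"
  proof (rule minimal_sublinear_linear)
    show "sublinear m" using m by (simp add: S_def)
    fix r
    assume r: "sublinear r" "\<And>x. r x \<le> m x"
    then have "r \<le> m" by (simp add: le_fun_def)
    then show "r = m"
      using m r(1) order_trans[of r m p] by (intro min) (simp_all add: S_def)
  qed
  then show ?thesis
    using m by (intro that[of m]) (auto simp: S_def le_fun_def)
qed

section \<open>Norming functionals over real and complex scalars\<close>

lemma real_norming_functional:
  fixes z :: "'a::real_normed_vector"
  obtains f :: "'a \<Rightarrow> real" where "linear f" "\<And>x. f x \<le> norm x" "f z = norm z"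
proof -
  have n: "sublinear (norm :: 'a \<Rightarrow> real)"
    by (simp add: sublinear_def norm_triangle_ineq)
  obtain f where f: "linear f" and le: "\<And>x. f x \<le> sublinear_perturb norm z x"
    using linear_le_sublinear[OF sublinear_sublinear_perturb[OF n, of z]] by blast
  have norm: "f x \<le> norm x" for x
    using le[of x] sublinear_perturb_le[OF n, of 0 z x] by simp
  \<comment> \<open>At \<open>- z\<close> the term \<open>t = 1\<close> of the perturbation is
    \<open>norm 0 - norm z\<close>.\<close>
  have "f (- z) \<le> - norm z"
    using le[of "- z"] sublinear_perturb_le[OF n, of 1 z "- z"] by simp
  then have "f z = norm z"
    using norm[of z] by (simp add: linear_neg[OF f])
  with f norm show ?thesis by (rule that)
qed

text \<open>
  In the complex case the functional is \<open>x \<mapsto> f x - \<i> f (\<i> x)\<close>, where \<open>f\<close> is a real norming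
  functional; \<open>j\<close> below is the element of \<open>'k\<close> that corresponds to \<open>\<i>\<close>.
\<close>

lemma (in banach_space_over) norming_functional:
  obtains \<phi> where "\<phi> \<in> dual_space scl" "norm \<phi> \<le> 1" "norm z \<le> norm (blinfun_apply \<phi> z)"
proof -
  obtain f :: "'x \<Rightarrow> real" where f: "linear f" and f_le: "\<And>x. f x \<le> norm x" and fz: "f z = norm z"
    using real_norming_functional by blast
  obtain h :: "'k \<Rightarrow> complex" where
    h_add: "\<And>x y. h (x + y) = h x + h y" and
    h_mult: "\<And>x y. h (x * y) = h x * h y" and
    h_scale: "\<And>r x. h (r *\<^sub>R x) = r *\<^sub>R h x" and
    h_norm: "\<And>x. norm (h x) = norm x" and
    h_range: "range h = \<real> \<or> range h = UNIV"
    using ex_iso_real_or_complex by blast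
  have h_diff: "h (x - y) = h x - h y" for x y
    using h_add[of "x - y" y] by simp
  have h_inj: "x = y" if "h x = h y" for x y
    using h_norm[of "x - y"] that by (simp add: h_diff)
  \<comment> \<open>A nonzero idempotent of a field is \<open>1\<close>, so \<open>h\<close> is
    unital.\<close>
  have "h 1 * h 1 = h 1" "h 1 \<noteq> 0"
    using h_mult[of 1 1] h_norm[of 1] by auto
  then have h_1: "h 1 = 1" by simp
  have h_real: "h (of_real r) = of_real r" for r
    using h_scale[of r 1] by (simp add: h_1 scaleR_conv_of_real)
  have f_abs: "\<bar>f x\<bar> \<le> norm x" for x
    using f_le[of x] f_le[of "- x"] by (simp add: linear_neg[OF f])
  have scl_scaleR: "scl c (r *\<^sub>R x) = r *\<^sub>R scl c x" for c r x
    by (metis scl_of_real scale_left_commute)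
  have "\<exists>g. linear g \<and> (\<forall>c x. g (scl c x) = c * g x) \<and> (\<forall>x. norm (g x) \<le> norm x)
      \<and> norm z \<le> norm (g z)"
    using h_range
  proof
    assume R: "range h = \<real>"
    define g :: "'x \<Rightarrow> 'k" where "g x = of_real (f x)" for x
    have "g (scl c x) = c * g x" for c x
    proof -
      obtain r where "h c = of_real r" using R by (metis Reals_cases rangeI)
      then have "c = of_real r" by (simp add: h_inj h_real)
      then show ?thesis by (simp add: g_def scl_of_real linear_scale[OF f])
    qed
    moreover have "linear g"
      by (rule linearI)
        (simp_all add: g_def linear_add[OF f] linear_scale[OF f] scaleR_conv_of_real)
    ultimately show ?thesis
      using f_abs by (intro exI[of _ g]) (simp add: g_def fz)
  next
    assume C: "range h = UNIV"
    obtain j where j: "h j = \<i>" using C by (metis surjD)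
    have jj: "j * j = - 1"
      using h_diff[of 0 1] h_mult[of j j] h_diff[of 0 0] by (intro h_inj) (simp add: j h_1)
    define g :: "'x \<Rightarrow> 'k" where "g x = of_real (f x) - j * of_real (f (scl j x))" for x
    \<comment> \<open>The real part of \<open>g\<close>, seen through \<open>h\<close>, is
      \<open>f\<close>; both norm estimates below rest on this.\<close>
    have h_g: "h (g x) = Complex (f x) (- f (scl j x))" for x
      by (simp add: g_def h_diff h_mult h_real j complex_eq_iff)
    have g_add: "g (x + y) = g x + g y" for x y
      by (simp add: g_def linear_add[OF f] scale_right_distrib algebra_simps)
    have g_scale: "g (r *\<^sub>R x) = of_real r * g x" for r x
      by (simp add: g_def linear_scale[OF f] scl_scaleR algebra_simps)
    have g_j: "g (scl j x) = j * g x" for x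
    proof -
      have "f (scl j (scl j x)) = - f x"
        by (simp add: jj linear_neg[OF f] scale_minus_left)
      moreover have "j * (j * y) = - y" for y
        using jj by (simp flip: mult.assoc)
      ultimately show ?thesis by (simp add: g_def right_diff_distrib del: scale_scale)
    qed
    have g_scl: "g (scl c x) = c * g x" for c x
    proof -
      \<comment> \<open>\<open>1\<close> and \<open>j\<close> span the scalars over the reals, so
        real linearity and \<open>g_j\<close> give linearity over \<open>'k\<close>.\<close>
      have "c = of_real (Re (h c)) + of_real (Im (h c)) * j"
        by (rule h_inj) (simp add: h_add h_mult h_real j complex_eq_iff)
      then obtain a b where c: "c = of_real a + of_real b * j" by blast
      have "scl c x = a *\<^sub>R x + b *\<^sub>R scl j x"
        by (simp add: c scale_left_distrib scl_of_real flip: scale_scale)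
      then show ?thesis
        by (simp add: g_add g_scale g_j c algebra_simps)
    qed
    have "linear g"
      by (rule linearI) (simp_all add: g_add g_scale scaleR_conv_of_real)
    moreover have "norm (g x) \<le> norm x" for x
    proof (cases "g x = 0")
      case False
      \<comment> \<open>A unimodular scalar that rotates \<open>g x\<close> onto the nonnegative
        axis, where \<open>g\<close> and \<open>f\<close> agree; hence
        \<open>norm (g x) = f (scl c x) \<le> norm x\<close>.\<close>
      define c where "c = of_real (norm (g x)) / g x"
      have "g (scl c x) = of_real (norm (g x))"
        using False by (simp add: g_scl c_def)
      then have "f (scl c x) = norm (g x)"
        using h_g[of "scl c x"] by (simp add: h_real complex_eq_iff)
      moreover have "norm c = 1"
        using False by (simp add: c_def norm_divide)
      ultimately show ?thesis
        using f_le[of "scl c x"] by (simp add: norm_scl)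
    qed simp
    moreover have "norm z \<le> norm (g z)"
      using abs_Re_le_cmod[of "h (g z)"] by (simp add: h_norm) (simp add: h_g fz)
    ultimately show ?thesis using g_scl by blast
  qed
  then obtain g where g: "linear g" "\<And>c x. g (scl c x) = c * g x"
      "\<And>x. norm (g x) \<le> norm x" "norm z \<le> norm (g z)"
    by blast
  have bl: "bounded_linear g"
    using g(1,3) by (auto simp: linear_conv_bounded_linear bounded_linear_def
        bounded_linear_axioms_def linear_iff module_hom_def intro!: exI[of _ 1])
  show ?thesis
  proof (rule that)
    show "Blinfun g \<in> dual_space scl"
      by (simp add: dual_space_def bounded_linear_Blinfun_apply[OF bl] g(2))
    show "norm (Blinfun g) \<le> 1"
      by (rule norm_blinfun_bound) (simp_all add: bounded_linear_Blinfun_apply[OF bl] g(3))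
    show "norm z \<le> norm (blinfun_apply (Blinfun g) z)"
      by (simp add: bounded_linear_Blinfun_apply[OF bl] g(4))
  qed
qed

section \<open>Evolution operators and the stability estimate\<close>

lemma evolution_compose:
  assumes "n \<le> m" "p \<le> n"
  shows "evolution A m p = evolution A m n o\<^sub>L evolution A n p"
  using assms
proof (induction m)
  case (Suc m)
  show ?case
  \<comment> \<open>Here the induction hypothesis does not apply, but the left factor is the
    identity.\<close>
  proof (cases "n = Suc m")
    case True
    then show ?thesis by (simp only: evolution_refl) (auto intro: blinfun_eqI)
  next
    case False
    then show ?thesis using Suc by (auto intro!: blinfun_eqI)
  qed
qed (auto intro: blinfun_eqI)

theorem theorem5:
  fixes scl :: "'k::real_or_complex \<Rightarrow> 'x::banach \<Rightarrow> 'x"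
    and A :: "nat \<Rightarrow> 'x \<Rightarrow>\<^sub>L 'x"
  assumes "banach_space_over scl"
    and "\<And>n. A n \<in> bounded_operators scl"
    and "\<exists>(b::real) N. b > 0 \<and> nondecreasing_bound N \<and>
           (\<forall>m n. n \<le> m \<longrightarrow>
             (\<forall>\<phi>\<in>dual_space scl.
               (\<Sum>k=n..m. exp (b * (real m - real k)) * norm (dual_operator (evolution A m k) \<phi>))
                 \<le> N (real n) * norm \<phi>))"
  shows "nonuniformly_exponentially_stable A"
proof -
  interpret banach_space_over scl by fact
  obtain b N where b: "b > 0" and N: "nondecreasing_bound N"
    and bound: "\<And>m n \<phi>. n \<le> m \<Longrightarrow> \<phi> \<in> dual_space scl \<Longrightarrow>
      (\<Sum>k=n..m. exp (b * (real m - real k)) * norm (dual_operator (evolution A m k) \<phi>))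
        \<le> N (real n) * norm \<phi>"
    using assms(3) by blast
  have "norm (evolution A m p x) \<le> N (real n) * exp (- b * (real m - real n)) * norm (evolution A n p x)"
    if mn: "n \<le> m" and np: "p \<le> n" for m n p x
  proof -
    define y where "y = evolution A n p x"
    have y: "evolution A m p x = evolution A m n y"
      by (simp add: evolution_compose[OF mn np] y_def)
    obtain \<phi> where \<phi>: "\<phi> \<in> dual_space scl" "norm \<phi> \<le> 1"
      and z: "norm (evolution A m n y) \<le> norm (\<phi> (evolution A m n y))"
      using norming_functional by blast
    have N1: "N (real n) \<ge> 1"
      using N by (auto simp: nondecreasing_bound_def)
    define E where "E = exp (b * (real m - real n))"
    have "E * norm (dual_operator (evolution A m n) \<phi>)
        \<le> (\<Sum>k=n..m. exp (b * (real m - real k)) * norm (dual_operator (evolution A m k) \<phi>))"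
      unfolding E_def
      by (rule member_le_sum[where f = "\<lambda>k. exp (b * (real m - real k)) * norm (dual_operator (evolution A m k) \<phi>)"])
        (use mn in auto)
    also have "\<dots> \<le> N (real n) * norm \<phi>"
      by (rule bound[OF mn \<phi>(1)])
    \<comment> \<open>Dropping \<open>norm \<phi> \<le> 1\<close> uses that
      \<open>N (real n)\<close> is nonnegative.\<close>
    also have "\<dots> \<le> N (real n)"
      using N1 \<phi>(2) by (simp add: mult_left_le)
    finally have "norm (dual_operator (evolution A m n) \<phi>) \<le> N (real n) * inverse E"
      by (simp add: E_def field_simps)
    \<comment> \<open>The value of \<open>\<phi>\<close> at the evolved vector is the value of the
      dual functional at \<open>y\<close>.\<close>
    moreover have "norm (\<phi> (evolution A m n y)) \<le> norm (dual_operator (evolution A m n) \<phi>) * norm y"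
      using norm_blinfun[of "dual_operator (evolution A m n) \<phi>" y]
      by (simp add: dual_operator_def)
    ultimately have "norm (evolution A m n y) \<le> N (real n) * inverse E * norm y"
      using z by (meson mult_right_mono norm_ge_zero order_trans)
    then show ?thesis
      by (simp add: y E_def exp_minus flip: y_def)
  qed
  then show ?thesis
    unfolding nonuniformly_exponentially_stable_def using b N by blast
qed

end
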